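(* Let $n\ge 1$, let $\lambda$ be a partition of $n$, let $k$ be a field, and let $(T_i)_i$ be the standard Young tableaux of shape $\lambda$. In the group algebra $kS_n$ put $p_{ij}=P_i\,\sigma_{ij}\,N_j$, where $P_i$ is the row symmetriser of $T_i$, $N_j$ is the column antisymmetriser of $T_j$, and $\sigma_{ij}$ is the permutation carrying $T_i$ to $T_j$. Then the elements $p_{ij}$ satisfy the projector relations: there exist scalars $g_{jk'}\in k$ (indexed by pairs of tableaux) such that $$p_{ij}\,p_{k'l}=g_{jk'}\,p_{il}\qquad\text{for all } i,j,k',l.$$
   Context: A standard Young tableau of shape $\lambda$ is a filling of the Young frame of $\lambda$ by the symbols $1,\dots,n$, each used once, with rows and columns increasing. Permutations act on symbols on the right, and a product $st$ in $S_n$ means first $s$, then $t$; $T_i s$ denotes the tableau obtained from $T_i$ by replacing each symbol $x$ by its image under $s$. The row symmetriser $P_i\in kS_n$ is the sum of all permutations that preserve each row of $T_i$ as a set of symbols. The column antisymmetriser $N_i\in kS_n$ is $\sum_v \pi(v)\,v$ over all permutations $v$ that preserve each column of $T_i$ as a set of symbols, where $\pi(v)=+1$ for even $v$ and $-1$ for odd $v$. The permutation $\sigma_{ij}$ is the unique one with $T_i\sigma_{ij}=T_j$; thus $N_i\sigma_{ij}=\sigma_{ij}N_j$ and $P_i\sigma_{ij}=\sigma_{ij}P_j$. *)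

theory Defs
  imports Complex_Main "HOL-Library.FuncSet" "HOL-Combinatorics.Permutations"
begin

definition partition_of :: "nat \<Rightarrow> nat list \<Rightarrow> bool" where
  "partition_of n lam \<longleftrightarrow>
     sorted_wrt (\<ge>) lam \<and> (\<forall>m\<in>set lam. 0 < m) \<and> sum_list lam = n"

(* Boxes are pairs (row, column), counted from 0. *)
definition frame :: "nat list \<Rightarrow> (nat \<times> nat) set" where
  "frame lam = {(r, c). r < length lam \<and> c < lam ! r}"

type_synonym tableau = "nat \<times> nat \<Rightarrow> nat"

(* Tableaux are extensional on the frame, so that equal fillings are equal functions. *)
definition std_tableaux :: "nat \<Rightarrow> nat list \<Rightarrow> tableau set" where
  "std_tableaux n lam = {T \<in> extensional (frame lam).
     bij_betw T (frame lam) {1..n} \<and>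
     (\<forall>r c c'. (r, c) \<in> frame lam \<longrightarrow> (r, c') \<in> frame lam \<longrightarrow> c < c' \<longrightarrow> T (r, c) < T (r, c')) \<and>
     (\<forall>r r' c. (r, c) \<in> frame lam \<longrightarrow> (r', c) \<in> frame lam \<longrightarrow> r < r' \<longrightarrow> T (r, c) < T (r', c))}"

definition tab_act :: "nat list \<Rightarrow> tableau \<Rightarrow> (nat \<Rightarrow> nat) \<Rightarrow> tableau" where
  "tab_act lam T s = restrict (\<lambda>b. s (T b)) (frame lam)"

definition tab_perm :: "nat \<Rightarrow> nat list \<Rightarrow> tableau \<Rightarrow> tableau \<Rightarrow> nat \<Rightarrow> nat" where
  "tab_perm n lam T T' = (THE s. s permutes {1..n} \<and> tab_act lam T s = T')"

lemma tab_perm_ex1: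
  assumes T: "T \<in> std_tableaux n lam" and T': "T' \<in> std_tableaux n lam"
  shows "\<exists>!s. s permutes {1..n} \<and> tab_act lam T s = T'"
proof -
  have b: "bij_betw T (frame lam) {1..n}" "bij_betw T' (frame lam) {1..n}" "T' \<in> extensional (frame lam)"
    using T T' unfolding std_tableaux_def mem_Collect_eq by blast+
  let ?I = "inv_into (frame lam) T"
  define s where "s = (\<lambda>x. if x \<in> {1..n} then T' (?I x) else x)"
  have bi: "bij_betw ?I {1..n} (frame lam)" by (rule bij_betw_inv_into[OF b(1)])
  have bs: "bij_betw (T' \<circ> ?I) {1..n} {1..n}" by (rule bij_betw_trans[OF bi b(2)])
  have "s x = (T' \<circ> ?I) x" if "x \<in> {1..n}" for x
    using that unfolding s_def comp_apply by (rule if_P)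
  then have "bij_betw s {1..n} {1..n}" using bs bij_betw_cong[of "{1..n}" s "T' \<circ> ?I"] by blast
  then have s1: "s permutes {1..n}" by (rule bij_imp_permutes) (unfold s_def, erule if_not_P)
  have s2: "tab_act lam T s = T'"
  proof
    fix x show "tab_act lam T s x = T' x"
    proof (cases "x \<in> frame lam")
      case True
      have "T x \<in> {1..n}" by (rule bij_betw_apply[OF b(1) True])
      then have "s (T x) = T' (?I (T x))" unfolding s_def by (rule if_P)
      then show ?thesis unfolding tab_act_def restrict_apply'[OF True] bij_betw_inv_into_left[OF b(1) True] .
    next
      case False
      then show ?thesis unfolding tab_act_def extensional_arb[OF b(3) False] by (rule restrict_apply[THEN trans, OF if_not_P])
    qed
  qed
  show ?thesis
  proof (rule ex1I[of _ s])
    show "s permutes {1..n} \<and> tab_act lam T s = T'" using s1 s2 ..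
  next
    fix u assume u: "u permutes {1..n} \<and> tab_act lam T u = T'"
    show "u = s"
    proof
      fix x show "u x = s x"
      proof (cases "x \<in> {1..n}")
        case True
        then have "x \<in> T ` frame lam" using bij_betw_imp_surj_on[OF b(1)] by simp
        then obtain y where y: "y \<in> frame lam" "x = T y" by (rule imageE)
        have "tab_act lam T u y = tab_act lam T s y" unfolding conjunct2[OF u] s2 ..
        then show ?thesis unfolding tab_act_def restrict_apply'[OF y(1)] y(2) .
      next
        case False
        show ?thesis unfolding permutes_not_in[OF conjunct1[OF u] False] permutes_not_in[OF s1 False] ..
      qed
    qed
  qed
qed

definition row_set :: "nat list \<Rightarrow> tableau \<Rightarrow> nat \<Rightarrow> nat set" where
  "row_set lam T r = T ` {b \<in> frame lam. fst b = r}"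

definition col_set :: "nat list \<Rightarrow> tableau \<Rightarrow> nat \<Rightarrow> nat set" where
  "col_set lam T c = T ` {b \<in> frame lam. snd b = c}"

definition row_group :: "nat \<Rightarrow> nat list \<Rightarrow> tableau \<Rightarrow> (nat \<Rightarrow> nat) set" where
  "row_group n lam T = {s. s permutes {1..n} \<and> (\<forall>r. s ` row_set lam T r = row_set lam T r)}"

definition col_group :: "nat \<Rightarrow> nat list \<Rightarrow> tableau \<Rightarrow> (nat \<Rightarrow> nat) set" where
  "col_group n lam T = {s. s permutes {1..n} \<and> (\<forall>c. s ` col_set lam T c = col_set lam T c)}"

(* An element of the group algebra of the symmetric group on {1..n} is given by its
   coefficient function, which vanishes on functions that do not permute {1..n}. *)
type_synonym 'k grp_alg = "(nat \<Rightarrow> nat) \<Rightarrow> 'k"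

(* The product st of permutations is first s, then t, i.e. the composite t \<circ> s. *)
definition ga_mult :: "nat \<Rightarrow> 'k::field grp_alg \<Rightarrow> 'k grp_alg \<Rightarrow> 'k grp_alg" where
  "ga_mult n a b = (\<lambda>u. \<Sum>(s, t) | s permutes {1..n} \<and> t permutes {1..n} \<and> t \<circ> s = u. a s * b t)"

definition ga_scale :: "'k::field \<Rightarrow> 'k grp_alg \<Rightarrow> 'k grp_alg" where
  "ga_scale c a = (\<lambda>u. c * a u)"

definition ga_perm :: "(nat \<Rightarrow> nat) \<Rightarrow> 'k::field grp_alg" where
  "ga_perm s = (\<lambda>u. if u = s then 1 else 0)"

definition row_symm :: "nat \<Rightarrow> nat list \<Rightarrow> tableau \<Rightarrow> 'k::field grp_alg" where
  "row_symm n lam T = (\<lambda>u. if u \<in> row_group n lam T then 1 else 0)"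

definition col_antisymm :: "nat \<Rightarrow> nat list \<Rightarrow> tableau \<Rightarrow> 'k::field grp_alg" where
  "col_antisymm n lam T = (\<lambda>u. if u \<in> col_group n lam T then of_int (sign u) else 0)"

definition proj_elt :: "nat \<Rightarrow> nat list \<Rightarrow> tableau \<Rightarrow> tableau \<Rightarrow> 'k::field grp_alg" where
  "proj_elt n lam T T' =
     ga_mult n (ga_mult n (row_symm n lam T) (ga_perm (tab_perm n lam T T'))) (col_antisymm n lam T')"

end

theory Submission
  imports Defs
begin

text \<open>
  Everything rests on von Neumann's sandwich identity for a single tableau \<open>T\<close>: for every
  element \<open>X\<close> of the group algebra, \<open>P\<^sub>T X N\<^sub>T\<close> is a scalar multiple of \<open>P\<^sub>T N\<^sub>T\<close>
  (\<open>sandwich_scalar\<close>). Granting it, move all the permutations \<open>\<sigma>\<close> past the symmetrisers: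
  \<open>p\<^sub>i\<^sub>j = \<sigma>\<^sub>i\<^sub>j P\<^sub>j N\<^sub>j\<close> and \<open>p\<^sub>k\<^sub>l = P\<^sub>k \<sigma>\<^sub>k\<^sub>j \<sigma>\<^sub>j\<^sub>l N\<^sub>l = P\<^sub>k \<sigma>\<^sub>k\<^sub>j N\<^sub>j \<sigma>\<^sub>j\<^sub>l\<close>, so that

  \<open>p\<^sub>i\<^sub>j p\<^sub>k\<^sub>l = \<sigma>\<^sub>i\<^sub>j (P\<^sub>j (N\<^sub>j P\<^sub>k \<sigma>\<^sub>k\<^sub>j) N\<^sub>j) \<sigma>\<^sub>j\<^sub>l = g \<cdot> \<sigma>\<^sub>i\<^sub>j P\<^sub>j N\<^sub>j \<sigma>\<^sub>j\<^sub>l = g \<cdot> p\<^sub>i\<^sub>l\<close>,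

  where the scalar \<open>g\<close> belonging to \<open>X = N\<^sub>j P\<^sub>k \<sigma>\<^sub>k\<^sub>j\<close> involves only \<open>j\<close> and \<open>k\<close>.

  By linearity the sandwich identity has to be shown for a single permutation \<open>x\<close>. Multiplying
  \<open>x\<close> on the left by a row permutation \<open>p\<close> and on the right by a column permutation \<open>q\<close>
  changes \<open>P x N\<close> by the factor \<open>sign q\<close> (\<open>sandwich_coeff_absorb\<close>). If \<open>x\<close> sends two symbols
  of one row to a common column, then \<open>t x t' = x\<close> for a row transposition \<open>t\<close> and a column
  transposition \<open>t'\<close>, whence \<open>P x N = - P x N\<close>. The coefficients of \<open>P x N\<close> are integers, and as
  integers they vanish, so characteristic 2 needs no separate treatment. Otherwise \<open>x\<close> is a
  product of a row and a column permutation (\<open>row_col_factorisation\<close>) and \<open>P x N = \<plusminus> P N\<close>.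
  That factorisation is the combinatorial heart of the proof; it comes from a counting argument
  on the frame (\<open>separating_bijection_stays_in_frame\<close>).
\<close>

(* Keeps the interval {1..n} from being rewritten to {Suc 0..n}, where facts about it no longer match. *)
declare One_nat_def [simp del]

section \<open>Products in the group algebra\<close>

definition sym_group :: "nat \<Rightarrow> (nat \<Rightarrow> nat) set" where
  "sym_group n = {s. s permutes {1..n}}"

lemma mem_sym_group [simp]: "s \<in> sym_group n \<longleftrightarrow> s permutes {1..n}"
  by (simp add: sym_group_def)

lemma finite_sym_group: "finite (sym_group n)"
  by (simp add: sym_group_def finite_permutations)

lemma ga_mult_expand:
  "ga_mult n a b u = (\<Sum>s\<in>sym_group n. \<Sum>t\<in>sym_group n. if t \<circ> s = u then a s * b t else 0)"
proof -
  have "{(s, t). s permutes {1..n} \<and> t permutes {1..n} \<and> t \<circ> s = u}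
      = {z \<in> sym_group n \<times> sym_group n. snd z \<circ> fst z = u}" by auto
  then show ?thesis
    unfolding ga_mult_def
    by (simp add: sum.inter_filter finite_sym_group finite_cartesian_product
        sum.cartesian_product case_prod_unfold)
qed

text \<open>
  Pairing a product with an arbitrary function \<open>f\<close> reduces both bracketings of a threefold product
  to one triple sum: \<open>f\<close> is then the coefficient extraction of the outer multiplication.
\<close>

lemma sum_ga_mult:
  "(\<Sum>p\<in>sym_group n. f p * ga_mult n a b p)
     = (\<Sum>s\<in>sym_group n. \<Sum>t\<in>sym_group n. f (t \<circ> s) * (a s * b t))"
proof -
  have "(\<Sum>p\<in>sym_group n. f p * ga_mult n a b p)
      = (\<Sum>p\<in>sym_group n. \<Sum>s\<in>sym_group n. \<Sum>t\<in>sym_group n.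
           if t \<circ> s = p then f p * (a s * b t) else 0)"
    by (auto simp: ga_mult_expand sum_distrib_left intro!: sum.cong)
  also have "\<dots> = (\<Sum>s\<in>sym_group n. \<Sum>p\<in>sym_group n. \<Sum>t\<in>sym_group n.
           if t \<circ> s = p then f p * (a s * b t) else 0)"
    by (rule sum.swap)
  also have "\<dots> = (\<Sum>s\<in>sym_group n. \<Sum>t\<in>sym_group n. \<Sum>p\<in>sym_group n.
           if t \<circ> s = p then f p * (a s * b t) else 0)"
    by (rule sum.cong[OF refl], rule sum.swap)
  also have "\<dots> = (\<Sum>s\<in>sym_group n. \<Sum>t\<in>sym_group n. f (t \<circ> s) * (a s * b t))"
    by (intro sum.cong refl) (simp add: finite_sym_group permutes_compose)
  finally show ?thesis .
qed

lemma ga_mult_triple: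
  "ga_mult n (ga_mult n a b) c u
     = (\<Sum>s\<in>sym_group n. \<Sum>t\<in>sym_group n. \<Sum>w\<in>sym_group n.
          if w \<circ> t \<circ> s = u then a s * b t * c w else 0)"
proof -
  have "ga_mult n (ga_mult n a b) c u
      = (\<Sum>p\<in>sym_group n. (\<Sum>w\<in>sym_group n. if w \<circ> p = u then c w else 0) * ga_mult n a b p)"
    unfolding ga_mult_expand[of n "ga_mult n a b"] sum_distrib_right
    by (auto simp: mult.commute intro!: sum.cong)
  also have "\<dots> = (\<Sum>s\<in>sym_group n. \<Sum>t\<in>sym_group n. \<Sum>w\<in>sym_group n.
          if w \<circ> t \<circ> s = u then a s * b t * c w else 0)"
    unfolding sum_ga_mult unfolding sum_distrib_right
    by (intro sum.cong refl) (auto simp: comp_assoc mult.commute)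
  finally show ?thesis .
qed

lemma ga_mult_assoc: "ga_mult n (ga_mult n a b) c = ga_mult n a (ga_mult n b c)"
proof
  fix u
  have "ga_mult n a (ga_mult n b c) u
      = (\<Sum>s\<in>sym_group n. \<Sum>p\<in>sym_group n. (if p \<circ> s = u then a s else 0) * ga_mult n b c p)"
    unfolding ga_mult_expand[of n a] by (auto intro!: sum.cong)
  also have "\<dots> = ga_mult n (ga_mult n a b) c u"
    unfolding sum_ga_mult ga_mult_triple by (auto simp: mult.assoc intro!: sum.cong)
  finally show "ga_mult n (ga_mult n a b) c u = ga_mult n a (ga_mult n b c) u" by simp
qed

lemma ga_mult_scale_left: "ga_mult n (ga_scale c a) b = ga_scale c (ga_mult n a b)"
  by (rule ext)
    (auto simp: ga_mult_expand ga_scale_def sum_distrib_left mult.assoc intro!: sum.cong)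

lemma ga_mult_scale_right: "ga_mult n a (ga_scale c b) = ga_scale c (ga_mult n a b)"
  by (rule ext)
    (auto simp: ga_mult_expand ga_scale_def sum_distrib_left mult.left_commute intro!: sum.cong)

lemma ga_mult_perm_right:
  assumes "x permutes {1..n}"
  shows "ga_mult n a (ga_perm x) u = (\<Sum>s\<in>sym_group n. if x \<circ> s = u then a s else 0)"
proof -
  have "ga_mult n a (ga_perm x) u
      = (\<Sum>s\<in>sym_group n. \<Sum>t\<in>sym_group n. if t = x then (if x \<circ> s = u then a s else 0) else 0)"
    unfolding ga_mult_expand ga_perm_def by (intro sum.cong refl) auto
  then show ?thesis using assms by (simp add: finite_sym_group)
qed

lemma ga_mult_perm_left:
  assumes "x permutes {1..n}"
  shows "ga_mult n (ga_perm x) a u = (\<Sum>t\<in>sym_group n. if t \<circ> x = u then a t else 0)"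
proof -
  have "ga_mult n (ga_perm x) a u
      = (\<Sum>s\<in>sym_group n. if s = x then \<Sum>t\<in>sym_group n. if t \<circ> x = u then a t else 0 else 0)"
    unfolding ga_mult_expand ga_perm_def
    by (intro sum.cong refl) (auto intro!: sum.cong sum.neutral)
  then show ?thesis using assms by (simp add: finite_sym_group)
qed

lemma ga_mult_perm_perm:
  assumes "x permutes {1..n}" "y permutes {1..n}"
  shows "ga_mult n (ga_perm x) (ga_perm y) = (ga_perm (y \<circ> x) :: 'k::field grp_alg)"
proof
  fix u
  have "ga_mult n (ga_perm x) (ga_perm y) u
      = (\<Sum>t\<in>sym_group n. if t = y then (ga_perm (y \<circ> x) u :: 'k) else 0)"
    unfolding ga_mult_perm_left[OF assms(1)] by (intro sum.cong refl) (auto simp: ga_perm_def)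
  then show "ga_mult n (ga_perm x) (ga_perm y) u = (ga_perm (y \<circ> x) u :: 'k)"
    using assms by (simp add: finite_sym_group)
qed

text \<open>
  Since products are read from left to right, \<open>x\<^sup>-\<^sup>1 s x\<close> in the group is the map
  \<open>x \<circ> s \<circ> inv x\<close>; the hypothesis thus says \<open>b = x\<^sup>-\<^sup>1 a x\<close>.
\<close>

lemma ga_mult_perm_conj:
  assumes x: "x permutes {1..n}"
    and eq: "\<And>s. s permutes {1..n} \<Longrightarrow> b (x \<circ> s \<circ> inv x) = a s"
  shows "ga_mult n a (ga_perm x) = ga_mult n (ga_perm x) b"
proof
  fix u
  have xi: "x \<circ> inv x = id" "inv x \<circ> x = id" using permutes_inv_o[OF x] by auto
  have ix: "inv x permutes {1..n}" by (rule permutes_inv[OF x])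
  have c1: "inv x \<circ> (x \<circ> s \<circ> inv x) \<circ> x = s" and c2: "x \<circ> (inv x \<circ> s \<circ> x) \<circ> inv x = s"
    and c3: "x \<circ> s \<circ> inv x \<circ> x = x \<circ> s" for s
    using xi by (simp_all add: fun_eq_iff)
  show "ga_mult n a (ga_perm x) u = ga_mult n (ga_perm x) b u"
    unfolding ga_mult_perm_right[OF x] ga_mult_perm_left[OF x]
    by (rule sum.reindex_bij_witness[of _ "\<lambda>t. inv x \<circ> t \<circ> x" "\<lambda>s. x \<circ> s \<circ> inv x"])
      (auto simp: c1 c2 c3 eq intro!: permutes_compose x ix)
qed

section \<open>Row and column groups\<close>

text \<open>The common shape of row and column groups, so that closure properties are proved once.\<close>

definition young_group :: "nat \<Rightarrow> (nat \<Rightarrow> nat set) \<Rightarrow> (nat \<Rightarrow> nat) set" where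
  "young_group n B = {s. s permutes {1..n} \<and> (\<forall>r. s ` B r = B r)}"

lemma row_group_young: "row_group n lam T = young_group n (row_set lam T)"
  and col_group_young: "col_group n lam T = young_group n (col_set lam T)"
  by (simp_all add: row_group_def col_group_def young_group_def)

lemma young_group_compose:
  "s \<in> young_group n B \<Longrightarrow> t \<in> young_group n B \<Longrightarrow> t \<circ> s \<in> young_group n B"
  by (auto simp only: young_group_def mem_Collect_eq image_comp[symmetric] intro: permutes_compose)

lemma young_group_inv:
  assumes "s \<in> young_group n B" shows "inv s \<in> young_group n B"
proof -
  have s: "s permutes {1..n}" and B: "s ` B r = B r" for r
    using assms by (auto simp: young_group_def)
  have "inv s ` B r = B r" for r
    using B[of r] image_comp[of "inv s" s "B r"] permutes_inv_o(2)[OF s] by simp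
  then show ?thesis by (simp add: young_group_def permutes_inv[OF s])
qed

lemma young_group_conj:
  assumes x: "x permutes {1..n}" and s: "s permutes {1..n}"
  shows "x \<circ> s \<circ> inv x \<in> young_group n (\<lambda>r. x ` B r) \<longleftrightarrow> s \<in> young_group n B"
proof -
  have "(x \<circ> s \<circ> inv x) ` x ` B r = x ` s ` B r" for r
    by (simp add: image_image permutes_inverses[OF x])
  then have "(x \<circ> s \<circ> inv x) ` x ` B r = x ` B r \<longleftrightarrow> s ` B r = B r" for r
    using inj_image_eq_iff[OF permutes_inj[OF x]] by simp
  then show ?thesis
    using s by (simp add: young_group_def permutes_compose permutes_inv[OF x] x)
qed

lemma permutes_permutation: "s permutes {1..n::nat} \<Longrightarrow> permutation s"
  by (auto simp: permutation_permutes)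

lemma sign_conj:
  assumes "x permutes {1..n::nat}" "s permutes {1..n}"
  shows "sign (x \<circ> s \<circ> inv x) = sign s"
proof -
  have px: "permutation x" and pi: "permutation (inv x)" and ps: "permutation s"
    using assms by (auto intro: permutes_permutation permutes_inv)
  show ?thesis
    by (simp add: sign_compose[OF permutation_compose[OF px ps] pi] sign_compose[OF px ps]
        sign_inverse[OF px] mult.commute[of _ "sign s"] sign_idempotent)
qed

lemma row_set_tab_act: "row_set lam (tab_act lam T x) = (\<lambda>r. x ` row_set lam T r)"
  and col_set_tab_act: "col_set lam (tab_act lam T x) = (\<lambda>r. x ` col_set lam T r)"
  by (auto simp: row_set_def col_set_def tab_act_def fun_eq_iff image_iff)

lemma row_symm_conj:
  assumes "x permutes {1..n}"
  shows "ga_mult n (row_symm n lam T) (ga_perm x)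
       = ga_mult n (ga_perm x) (row_symm n lam (tab_act lam T x))"
  using assms by (intro ga_mult_perm_conj)
    (auto simp: row_symm_def row_group_young row_set_tab_act young_group_conj)

lemma col_antisymm_conj:
  assumes "x permutes {1..n}"
  shows "ga_mult n (col_antisymm n lam T) (ga_perm x)
       = ga_mult n (ga_perm x) (col_antisymm n lam (tab_act lam T x))"
  using assms by (intro ga_mult_perm_conj)
    (auto simp: col_antisymm_def col_group_young col_set_tab_act young_group_conj sign_conj)

section \<open>Factoring a permutation through rows and columns\<close>

lemma finite_frame: "finite (frame lam)"
proof -
  have "frame lam = (SIGMA r:{..<length lam}. {..<lam ! r})" by (auto simp: frame_def)
  then show ?thesis by simp
qed

text \<open>
  The boxes \<open>(fst b, snd (y b))\<close> form a set \<open>M\<close> having as many boxes in each row and each column as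
  the frame, and the rows of the frame are left-justified. Among the first \<open>j\<close> columns a row of
  \<open>M\<close> can therefore contain at most as many boxes as that row of the frame. The totals over all
  rows agree because \<open>y\<close> is a bijection, so there is equality row by row. Taking \<open>j\<close> to be the
  length of the row of \<open>b\<close> forces this row of \<open>M\<close> into the frame.
\<close>

lemma separating_bijection_stays_in_frame:
  assumes y: "bij_betw y (frame lam) (frame lam)"
    and inj: "inj_on (\<lambda>b. (fst b, snd (y b))) (frame lam)"
    and b: "b \<in> frame lam"
  shows "(fst b, snd (y b)) \<in> frame lam"
proof -
  define j where "j = lam ! fst b"
  define A where "A r = {b \<in> frame lam. fst b = r \<and> snd (y b) < j}" for r
  define B where "B r = {b \<in> frame lam. fst b = r \<and> snd b < j}" for r
  have finA: "finite (A r)" and finB: "finite (B r)" for r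
    by (simp_all add: A_def B_def finite_frame)
  have le: "card (A r) \<le> card (B r)" if r: "r < length lam" for r
  proof (cases "lam ! r \<le> j")
    case True
    then have "A r \<subseteq> B r" by (auto simp: A_def B_def frame_def)
    then show ?thesis by (rule card_mono[OF finB])
  next
    case False
    then have "B r = Pair r ` {..<j}" using r by (auto simp: B_def frame_def)
    then have "card (B r) = j" by (simp add: card_image inj_on_def)
    moreover have "card (A r) \<le> card {..<j}"
    proof (rule card_inj_on_le)
      show "inj_on (\<lambda>b. snd (y b)) (A r)"
        using inj by (auto simp: inj_on_def A_def)
    qed (auto simp: A_def)
    ultimately show ?thesis by simp
  qed
  have tot: "(\<Sum>r<length lam. card (A r)) = (\<Sum>r<length lam. card (B r))"
  proof -
    have "(\<Sum>r<length lam. card (A r)) = card (\<Union>r<length lam. A r)"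
      by (subst card_UN_disjoint) (auto simp: finA, auto simp: A_def)
    also have "(\<Union>r<length lam. A r) = {b \<in> frame lam. snd (y b) < j}"
      by (auto simp: A_def frame_def)
    also have "card \<dots> = card {b \<in> frame lam. snd b < j}"
    proof (rule bij_betw_same_card[of y])
      show "bij_betw y {b \<in> frame lam. snd (y b) < j} {b \<in> frame lam. snd b < j}"
      proof (rule bij_betw_imageI)
        show "inj_on y {b \<in> frame lam. snd (y b) < j}"
          using bij_betw_imp_inj_on[OF y] by (rule inj_on_subset) auto
        have "y ` {b \<in> frame lam. snd (y b) < j} = {b \<in> y ` frame lam. snd b < j}" by auto
        then show "y ` {b \<in> frame lam. snd (y b) < j} = {b \<in> frame lam. snd b < j}"
          by (simp only: bij_betw_imp_surj_on[OF y])
      qed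
    qed
    also have "{b \<in> frame lam. snd b < j} = (\<Union>r<length lam. B r)"
      by (auto simp: B_def frame_def)
    also have "card \<dots> = (\<Sum>r<length lam. card (B r))"
      by (subst card_UN_disjoint) (auto simp: finB, auto simp: B_def)
    finally show ?thesis .
  qed
  have fb: "fst b < length lam" using b by (auto simp: frame_def)
  have "card (A (fst b)) = card (B (fst b))"
    by (rule sum_mono_inv[OF tot]) (use le fb in auto)
  moreover have "A (fst b) \<subseteq> B (fst b)" by (auto simp: A_def B_def frame_def j_def)
  ultimately have "A (fst b) = B (fst b)" by (simp add: card_subset_eq finB)
  moreover have "b \<in> B (fst b)" using b by (auto simp: B_def frame_def j_def)
  ultimately have "snd (y b) < j" by (auto simp: A_def)
  then show ?thesis using fb by (auto simp: frame_def j_def)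
qed

lemma transpose_in_young_group:
  assumes "a \<in> B r" "b \<in> B r" "a \<in> {1..n}" "b \<in> {1..n}"
    and disj: "\<And>r r'. r \<noteq> r' \<Longrightarrow> B r \<inter> B r' = {}"
  shows "transpose a b \<in> young_group n B"
proof -
  have "transpose a b ` B r' = B r'" for r'
  proof (cases "r' = r")
    case True then show ?thesis using assms by simp
  next
    case False
    then have "a \<notin> B r'" "b \<notin> B r'" using disj[OF False] assms by auto
    then show ?thesis by simp
  qed
  then show ?thesis using assms by (simp add: young_group_def permutes_swap_id)
qed

lemma row_set_disjoint:
  assumes "inj_on T (frame lam)" "r \<noteq> r'"
  shows "row_set lam T r \<inter> row_set lam T r' = {}"
  using assms by (auto simp: row_set_def inj_on_def)

lemma col_set_disjoint:
  assumes "inj_on T (frame lam)" "c \<noteq> c'"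
  shows "col_set lam T c \<inter> col_set lam T c' = {}"
  using assms by (auto simp: col_set_def inj_on_def)

text \<open>
  The row permutation \<open>p\<close> must move each symbol \<open>a\<close> within its row into the column of \<open>x a\<close>. The
  box where \<open>a\<close> has to go lies in the frame by the preceding counting argument, and distinct
  symbols go to distinct boxes by the separation hypothesis. What remains, \<open>q = x \<circ> p\<^sup>-\<^sup>1\<close>,
  then moves symbols within their columns.
\<close>

lemma row_col_factorisation:
  assumes T: "bij_betw T (frame lam) {1..n}" and x: "x permutes {1..n}"
    and sep: "\<And>r c a b. a \<in> row_set lam T r \<Longrightarrow> b \<in> row_set lam T r \<Longrightarrow>
      x a \<in> col_set lam T c \<Longrightarrow> x b \<in> col_set lam T c \<Longrightarrow> a = b"
  obtains p q where "p \<in> row_group n lam T" "q \<in> col_group n lam T" "x = q \<circ> p"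
proof -
  let ?F = "frame lam" and ?I = "inv_into (frame lam) T"
  have I: "bij_betw ?I {1..n} ?F" by (rule bij_betw_inv_into[OF T])
  have IT: "?I (T b) = b" if "b \<in> ?F" for b using bij_betw_inv_into_left[OF T that] .
  have TI: "T (?I a) = a" if "a \<in> {1..n}" for a using bij_betw_inv_into_right[OF T that] .
  have injT: "inj_on T ?F" using T by (rule bij_betw_imp_inj_on)
  \<comment> \<open>The permutations \<open>x\<close> and \<open>p\<close>, transported to boxes, are \<open>y\<close> and \<open>h\<close>.\<close>
  define y where "y b = ?I (x (T b))" for b
  have "bij_betw (?I \<circ> (x \<circ> T)) ?F ?F"
    by (rule bij_betw_trans[OF bij_betw_trans[OF T permutes_imp_bij[OF x]] I])
  then have y: "bij_betw y ?F ?F" by (simp add: y_def[abs_def] comp_def)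
  have xT: "x (T b) = T (y b)" if "b \<in> ?F" for b
    using TI[of "x (T b)"] permutes_in_image[OF x] bij_betw_apply[OF T that] by (simp add: y_def)
  define h where "h b = (fst b, snd (y b))" for b
  have injh: "inj_on h ?F"
  proof (rule inj_onI)
    fix b b' assume b: "b \<in> ?F" "b' \<in> ?F" and eq: "h b = h b'"
    have "y b \<in> ?F" "y b' \<in> ?F" using bij_betw_apply[OF y] b by auto
    then have "T b = T b'"
      using b eq by (intro sep[of "T b" "fst b" "T b'" "snd (y b)"])
        (auto simp: row_set_def col_set_def h_def xT)
    then show "b = b'" using injT b by (auto dest: inj_onD)
  qed
  have hF: "h b \<in> ?F" if "b \<in> ?F" for b
    using separating_bijection_stays_in_frame[OF y _ that] injh by (simp add: h_def[abs_def])
  have h: "bij_betw h ?F ?F"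
    unfolding bij_betw_def using injh hF by (intro conjI endo_inj_surj finite_frame) auto
  define p where "p a = (if a \<in> {1..n} then T (h (?I a)) else a)" for a
  have "bij_betw (T \<circ> (h \<circ> ?I)) {1..n} {1..n}"
    by (rule bij_betw_trans[OF bij_betw_trans[OF I h] T])
  then have "bij_betw p {1..n} {1..n}"
    by (subst bij_betw_cong[of _ _ "T \<circ> (h \<circ> ?I)"]) (auto simp: p_def)
  then have p: "p permutes {1..n}" by (rule bij_imp_permutes) (simp only: p_def if_False)
  have pT: "p (T b) = T (h b)" if "b \<in> ?F" for b
    using bij_betw_apply[OF T that] by (simp add: p_def IT[OF that])
  have finF: "finite {b \<in> ?F. Q b}" for Q by (simp add: finite_frame)
  have "p ` row_set lam T r = row_set lam T r" for r
  proof (rule endo_inj_surj)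
    show "finite (row_set lam T r)" by (simp add: row_set_def finF)
    show "p ` row_set lam T r \<subseteq> row_set lam T r"
      using pT hF by (auto simp: row_set_def h_def)
    show "inj_on p (row_set lam T r)" using permutes_inj[OF p] by (rule inj_on_subset) simp
  qed
  then have pR: "p \<in> row_group n lam T" using p by (simp add: row_group_def)
  define q where "q = x \<circ> inv p"
  have q: "q permutes {1..n}" unfolding q_def by (intro permutes_compose permutes_inv p x)
  have xqp: "x = q \<circ> p" by (simp add: q_def comp_assoc permutes_inv_o[OF p])
  have qT: "q (T (h b)) = T (y b)" if "b \<in> ?F" for b
    using xT[OF that] pT[OF that] by (simp add: xqp)
  have "q ` col_set lam T c = col_set lam T c" for c
  proof (rule endo_inj_surj)
    show "finite (col_set lam T c)" by (simp add: col_set_def finF)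
    show "inj_on q (col_set lam T c)" using permutes_inj[OF q] by (rule inj_on_subset) simp
    show "q ` col_set lam T c \<subseteq> col_set lam T c"
    proof
      fix z assume "z \<in> q ` col_set lam T c"
      then obtain b' where b': "b' \<in> ?F" "snd b' = c" "z = q (T b')" by (auto simp: col_set_def)
      obtain b where b: "b \<in> ?F" "b' = h b"
        using b'(1) bij_betw_imp_surj_on[OF h] by (metis imageE)
      have "z = T (y b)" by (simp only: b' b qT)
      moreover have "snd (y b) = c" using b b' by (simp add: h_def)
      moreover have "y b \<in> ?F" using bij_betw_apply[OF y b(1)] .
      ultimately show "z \<in> col_set lam T c" by (auto simp: col_set_def)
    qed
  qed
  then have "q \<in> col_group n lam T" using q by (simp add: col_group_def)
  then show ?thesis using that pR xqp by blast
qed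

section \<open>The sandwich identity\<close>

text \<open>
  The coefficient of \<open>u\<close> in the sandwich \<open>P\<^sub>T x N\<^sub>T\<close> over the integers. Keeping it an integer lets
  \<open>d = - d\<close> imply \<open>d = 0\<close> before passing to a field of possibly even characteristic.
\<close>

definition sandwich_coeff ::
  "nat \<Rightarrow> nat list \<Rightarrow> tableau \<Rightarrow> (nat \<Rightarrow> nat) \<Rightarrow> (nat \<Rightarrow> nat) \<Rightarrow> int" where
  "sandwich_coeff n lam T x u =
     (\<Sum>(s, w) | s \<in> row_group n lam T \<and> w \<in> col_group n lam T \<and> w \<circ> x \<circ> s = u. sign w)"

text \<open>
  This is \<open>P p = P\<close> and \<open>q N = sign q \<cdot> N\<close> at the level of coefficients. It serves twice: with
  \<open>x = id\<close> for permutations that factor, and with \<open>q \<circ> x \<circ> p = x\<close> for those that do not.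
\<close>

lemma sandwich_coeff_absorb:
  assumes p: "p \<in> row_group n lam T" and q: "q \<in> col_group n lam T"
  shows "sandwich_coeff n lam T (q \<circ> x \<circ> p) u = sign q * sandwich_coeff n lam T x u"
proof -
  let ?R = "row_group n lam T" and ?C = "col_group n lam T"
  have pp: "p permutes {1..n}" and pq: "q permutes {1..n}"
    using p q by (auto simp: row_group_def col_group_def)
  have ip: "inv p \<in> ?R" and iq: "inv q \<in> ?C"
    using p q by (simp_all add: row_group_young col_group_young young_group_inv)
  have R: "s \<in> ?R \<Longrightarrow> t \<in> ?R \<Longrightarrow> t \<circ> s \<in> ?R" and C: "s \<in> ?C \<Longrightarrow> t \<in> ?C \<Longrightarrow> t \<circ> s \<in> ?C" for s t
    by (simp_all add: row_group_young col_group_young young_group_compose)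
  have canc: "p \<circ> inv p \<circ> s = s" "inv p \<circ> p \<circ> s = s" "s \<circ> q \<circ> inv q = s" "s \<circ> inv q \<circ> q = s" for s
    using permutes_inv_o[OF pp] permutes_inv_o[OF pq] by (simp_all add: fun_eq_iff)
  have sgn: "sign q * sign (w \<circ> q) = sign w" if "w \<in> ?C" for w
  proof -
    have "permutation w" "permutation q"
      using that pq by (auto simp: col_group_def intro: permutes_permutation)
    then show ?thesis by (simp add: sign_compose sign_idempotent mult.left_commute[of "sign q"])
  qed
  show ?thesis
    unfolding sandwich_coeff_def sum_distrib_left
  proof (rule sum.reindex_bij_witness[of _ "\<lambda>(s, w). (inv p \<circ> s, w \<circ> inv q)"
        "\<lambda>(s, w). (p \<circ> s, w \<circ> q)"], goal_cases)
    case (4 z)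
    then obtain s w where z: "z = (s, w)" and sw: "s \<in> ?R" "w \<in> ?C" "w \<circ> x \<circ> s = u"
      by (cases z) auto
    have "w \<circ> inv q \<circ> (q \<circ> x \<circ> p) \<circ> (inv p \<circ> s) = (w \<circ> inv q \<circ> q) \<circ> x \<circ> (p \<circ> inv p \<circ> s)"
      by (simp only: comp_assoc)
    also have "\<dots> = u" by (simp only: canc sw)
    finally show ?case using sw z by (simp add: R C ip iq)
  next
    case (5 z)
    then show ?case using sgn by auto
  qed (auto simp: canc R C p q comp_assoc[symmetric] simp del: comp_apply)
qed

lemma sandwich_coeff_proportional:
  assumes T: "bij_betw T (frame lam) {1..n}" and x: "x permutes {1..n}"
  shows "\<exists>d. \<forall>u. sandwich_coeff n lam T x u = d * sandwich_coeff n lam T id u"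
proof (cases "\<exists>r c a b. a \<in> row_set lam T r \<and> b \<in> row_set lam T r \<and>
      x a \<in> col_set lam T c \<and> x b \<in> col_set lam T c \<and> a \<noteq> b")
  case True
  then obtain r c a b where ab: "a \<in> row_set lam T r" "b \<in> row_set lam T r"
      "x a \<in> col_set lam T c" "x b \<in> col_set lam T c" "a \<noteq> b" by blast
  have inj: "inj_on T (frame lam)" using T by (rule bij_betw_imp_inj_on)
  have sub: "row_set lam T r \<subseteq> {1..n}" "col_set lam T c \<subseteq> {1..n}"
    using bij_betw_apply[OF T] by (auto simp: row_set_def col_set_def)
  have p: "transpose a b \<in> row_group n lam T"
    unfolding row_group_young
    using ab sub by (intro transpose_in_young_group row_set_disjoint[OF inj]) auto
  have q: "transpose (x a) (x b) \<in> col_group n lam T"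
    unfolding col_group_young
    using ab sub by (intro transpose_in_young_group col_set_disjoint[OF inj]) auto
  have "x a \<noteq> x b" using ab permutes_inj[OF x] by (auto dest: injD)
  have stable: "transpose (x a) (x b) \<circ> x \<circ> transpose a b = x"
    by (rule ext) (simp add: transpose_def inj_eq[OF permutes_inj[OF x]])
  have "sign (transpose (x a) (x b)) = -1" using \<open>x a \<noteq> x b\<close> by (simp add: sign_swap_id)
  then have "sandwich_coeff n lam T x u = 0" for u
    using sandwich_coeff_absorb[OF p q, of x u] unfolding stable by simp
  then show ?thesis by (intro exI[of _ 0]) simp
next
  case False
  then obtain p q where p: "p \<in> row_group n lam T" and q: "q \<in> col_group n lam T" and "x = q \<circ> p"
    using row_col_factorisation[OF T x] by metis
  then show ?thesis using sandwich_coeff_absorb[OF p q, of id] by auto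
qed

lemma sandwich_ga_mult:
  "ga_mult n (ga_mult n (row_symm n lam T) X) (col_antisymm n lam T) u
     = (\<Sum>x\<in>sym_group n. X x * of_int (sandwich_coeff n lam T x u))"
proof -
  let ?R = "row_group n lam T" and ?C = "col_group n lam T"
  have sub: "?R \<subseteq> sym_group n" "?C \<subseteq> sym_group n"
    by (auto simp: row_group_def col_group_def)
  have fin: "finite ?R" "finite ?C" using sub finite_sym_group finite_subset by blast+
  have D: "sandwich_coeff n lam T x u
      = (\<Sum>s\<in>?R. \<Sum>w\<in>?C. if w \<circ> x \<circ> s = u then sign w else 0)" for x
  proof -
    have "{(s, w). s \<in> ?R \<and> w \<in> ?C \<and> w \<circ> x \<circ> s = u}
        = {z \<in> ?R \<times> ?C. snd z \<circ> x \<circ> fst z = u}" by auto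
    then show ?thesis unfolding sandwich_coeff_def
      by (simp add: sum.inter_filter fin sum.cartesian_product case_prod_unfold)
  qed
  have "ga_mult n (ga_mult n (row_symm n lam T) X) (col_antisymm n lam T) u
    = (\<Sum>x\<in>sym_group n. \<Sum>s\<in>sym_group n. \<Sum>w\<in>sym_group n.
        if w \<circ> x \<circ> s = u then row_symm n lam T s * X x * col_antisymm n lam T w else 0)"
    unfolding ga_mult_triple by (rule sum.swap)
  also have "\<dots> = (\<Sum>x\<in>sym_group n. \<Sum>s\<in>?R. \<Sum>w\<in>?C.
        if w \<circ> x \<circ> s = u then row_symm n lam T s * X x * col_antisymm n lam T w else 0)"
  proof (rule sum.cong[OF refl])
    fix x
    have "(\<Sum>s\<in>sym_group n. \<Sum>w\<in>sym_group n.
        if w \<circ> x \<circ> s = u then row_symm n lam T s * X x * col_antisymm n lam T w else 0)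
      = (\<Sum>s\<in>sym_group n. \<Sum>w\<in>?C.
        if w \<circ> x \<circ> s = u then row_symm n lam T s * X x * col_antisymm n lam T w else 0)"
      by (intro sum.cong refl sum.mono_neutral_right finite_sym_group sub)
        (auto simp: col_antisymm_def)
    also have "\<dots> = (\<Sum>s\<in>?R. \<Sum>w\<in>?C.
        if w \<circ> x \<circ> s = u then row_symm n lam T s * X x * col_antisymm n lam T w else 0)"
      by (intro sum.mono_neutral_right finite_sym_group sub) (auto simp: row_symm_def intro!: sum.neutral)
    finally show "(\<Sum>s\<in>sym_group n. \<Sum>w\<in>sym_group n.
        if w \<circ> x \<circ> s = u then row_symm n lam T s * X x * col_antisymm n lam T w else 0)
      = (\<Sum>s\<in>?R. \<Sum>w\<in>?C.
        if w \<circ> x \<circ> s = u then row_symm n lam T s * X x * col_antisymm n lam T w else 0)" .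
  qed
  also have "\<dots> = (\<Sum>x\<in>sym_group n. X x * of_int (sandwich_coeff n lam T x u))"
    unfolding D of_int_sum sum_distrib_left
    by (intro sum.cong refl) (auto simp: row_symm_def col_antisymm_def)
  finally show ?thesis .
qed

lemma ga_mult_symm_antisymm:
  "ga_mult n (row_symm n lam T) (col_antisymm n lam T) u = of_int (sandwich_coeff n lam T id u)"
proof -
  have "ga_mult n (row_symm n lam T) (ga_perm id) = (row_symm n lam T :: 'a grp_alg)"
  proof
    fix v
    have "ga_mult n (row_symm n lam T) (ga_perm id) v
        = (\<Sum>s\<in>sym_group n. if s = v then row_symm n lam T v else (0::'a))"
      by (subst ga_mult_perm_right[OF permutes_id]) (auto intro!: sum.cong)
    also have "\<dots> = row_symm n lam T v"
      by (auto simp: finite_sym_group row_symm_def row_group_def)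
    finally show "ga_mult n (row_symm n lam T) (ga_perm id) v = (row_symm n lam T v :: 'a)" .
  qed
  then have "ga_mult n (row_symm n lam T) (col_antisymm n lam T) u
    = (\<Sum>x\<in>sym_group n. ga_perm id x * (of_int (sandwich_coeff n lam T x u) :: 'a))"
    using sandwich_ga_mult[of n lam T "ga_perm id :: 'a grp_alg" u] by simp
  also have "\<dots> = (\<Sum>x\<in>sym_group n. if x = id then of_int (sandwich_coeff n lam T id u) else 0)"
    by (intro sum.cong refl) (auto simp: ga_perm_def)
  also have "\<dots> = of_int (sandwich_coeff n lam T id u)"
    by (simp add: finite_sym_group permutes_id)
  finally show ?thesis .
qed

lemma sandwich_scalar:
  fixes X :: "'k::field grp_alg"
  assumes T: "bij_betw T (frame lam) {1..n}"
  shows "\<exists>c. ga_mult n (ga_mult n (row_symm n lam T) X) (col_antisymm n lam T)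
    = ga_scale c (ga_mult n (row_symm n lam T) (col_antisymm n lam T))"
proof -
  obtain d where d: "\<And>x u. x permutes {1..n} \<Longrightarrow>
      sandwich_coeff n lam T x u = d x * sandwich_coeff n lam T id u"
    using sandwich_coeff_proportional[OF T] by metis
  show ?thesis
  proof (intro exI ext)
    fix u
    show "ga_mult n (ga_mult n (row_symm n lam T) X) (col_antisymm n lam T) u
      = ga_scale (\<Sum>x\<in>sym_group n. X x * of_int (d x))
          (ga_mult n (row_symm n lam T) (col_antisymm n lam T)) u"
      unfolding sandwich_ga_mult ga_scale_def ga_mult_symm_antisymm sum_distrib_right
    proof (rule sum.cong[OF refl])
      fix x assume "x \<in> sym_group n"
      then show "X x * of_int (sandwich_coeff n lam T x u)
          = X x * of_int (d x) * of_int (sandwich_coeff n lam T id u)"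
        by (subst d[of x u]) (simp_all add: mult.assoc)
    qed
  qed
qed

section \<open>The projector relations\<close>

lemma tab_perm:
  assumes "T \<in> std_tableaux n lam" "T' \<in> std_tableaux n lam"
  shows tab_perm_permutes: "tab_perm n lam T T' permutes {1..n}"
    and tab_act_tab_perm: "tab_act lam T (tab_perm n lam T T') = T'"
  using theI'[OF tab_perm_ex1[OF assms]] by (simp_all add: tab_perm_def)

lemma tab_perm_compose:
  assumes T: "T \<in> std_tableaux n lam" "T' \<in> std_tableaux n lam" "T'' \<in> std_tableaux n lam"
  shows "tab_perm n lam T' T'' \<circ> tab_perm n lam T T' = tab_perm n lam T T''"
proof -
  have "tab_act lam T (tab_perm n lam T' T'' \<circ> tab_perm n lam T T')
      = tab_act lam (tab_act lam T (tab_perm n lam T T')) (tab_perm n lam T' T'')"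
    by (auto simp: tab_act_def restrict_def)
  also have "\<dots> = T''" using T by (simp add: tab_act_tab_perm)
  finally have "tab_act lam T (tab_perm n lam T' T'' \<circ> tab_perm n lam T T') = T''" .
  moreover have "tab_perm n lam T' T'' \<circ> tab_perm n lam T T' permutes {1..n}"
    using T by (intro permutes_compose tab_perm_permutes)
  ultimately show ?thesis
    using tab_perm_ex1[OF T(1,3)] tab_perm_permutes[OF T(1,3)] tab_act_tab_perm[OF T(1,3)] by blast
qed

theorem mainTheorem1:
  fixes n :: nat and lam :: "nat list"
  assumes "n \<ge> 1" and "partition_of n lam"
  shows "\<exists>g :: tableau \<Rightarrow> tableau \<Rightarrow> 'k::field.
    \<forall>Ti \<in> std_tableaux n lam. \<forall>Tj \<in> std_tableaux n lam.
    \<forall>Tk \<in> std_tableaux n lam. \<forall>Tl \<in> std_tableaux n lam.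
      ga_mult n (proj_elt n lam Ti Tj) (proj_elt n lam Tk Tl)
        = ga_scale (g Tj Tk) (proj_elt n lam Ti Tl)"
proof -
  let ?P = "\<lambda>T. row_symm n lam T :: 'k grp_alg"
  let ?N = "\<lambda>T. col_antisymm n lam T :: 'k grp_alg"
  let ?s = "\<lambda>T T'. ga_perm (tab_perm n lam T T') :: 'k grp_alg"
  let ?S = "std_tableaux n lam"
  note assoc = ga_mult_assoc[of n]
  have P: "ga_mult n (?P T) (?s T T') = ga_mult n (?s T T') (?P T')" if "T \<in> ?S" "T' \<in> ?S" for T T'
    using row_symm_conj[OF tab_perm_permutes[OF that], of lam T] by (simp add: tab_act_tab_perm[OF that])
  have N: "ga_mult n (?N T) (?s T T') = ga_mult n (?s T T') (?N T')" if "T \<in> ?S" "T' \<in> ?S" for T T'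
    using col_antisymm_conj[OF tab_perm_permutes[OF that], of lam T] by (simp add: tab_act_tab_perm[OF that])
  have s: "ga_mult n (?s T T') (?s T' T'') = ?s T T''" if "T \<in> ?S" "T' \<in> ?S" "T'' \<in> ?S" for T T' T''
    using that by (simp add: ga_mult_perm_perm tab_perm_permutes tab_perm_compose)
  have "\<exists>c. T \<in> ?S \<longrightarrow> ga_mult n (ga_mult n (?P T) (ga_mult n (ga_mult n (?N T) (?P T')) (?s T' T))) (?N T)
      = ga_scale c (ga_mult n (?P T) (?N T))" for T T'
    using sandwich_scalar[of T lam n] by (auto simp: std_tableaux_def)
  then obtain g where g: "\<And>T T'. T \<in> ?S \<Longrightarrow>
      ga_mult n (ga_mult n (?P T) (ga_mult n (ga_mult n (?N T) (?P T')) (?s T' T))) (?N T)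
      = ga_scale (g T T') (ga_mult n (?P T) (?N T))" by metis
  show ?thesis
  proof (intro exI[of _ g] ballI)
    fix Ti Tj Tk Tl assume S: "Ti \<in> ?S" "Tj \<in> ?S" "Tk \<in> ?S" "Tl \<in> ?S"
    have left: "proj_elt n lam Ti Tj = ga_mult n (?s Ti Tj) (ga_mult n (?P Tj) (?N Tj))"
      using S by (simp add: proj_elt_def P assoc)
    have right: "proj_elt n lam T Tl = ga_mult n (ga_mult n (?P T) (?s T Tj)) (ga_mult n (?N Tj) (?s Tj Tl))"
      if "T \<in> ?S" for T
    proof -
      have "proj_elt n lam T Tl = ga_mult n (?P T) (ga_mult n (ga_mult n (?s T Tj) (?s Tj Tl)) (?N Tl))"
        using S that by (simp only: proj_elt_def s assoc)
      also have "\<dots> = ga_mult n (?P T) (ga_mult n (?s T Tj) (ga_mult n (?N Tj) (?s Tj Tl)))"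
        using S by (simp only: N assoc)
      finally show ?thesis by (simp only: assoc)
    qed
    have "ga_mult n (proj_elt n lam Ti Tj) (proj_elt n lam Tk Tl)
        = ga_mult n (?s Ti Tj) (ga_mult n
            (ga_mult n (ga_mult n (?P Tj) (ga_mult n (ga_mult n (?N Tj) (?P Tk)) (?s Tk Tj))) (?N Tj))
            (?s Tj Tl))"
      using S by (simp only: left right assoc)
    also have "\<dots> = ga_mult n (?s Ti Tj)
        (ga_mult n (ga_scale (g Tj Tk) (ga_mult n (?P Tj) (?N Tj))) (?s Tj Tl))"
      by (simp only: g[OF S(2)])
    also have "\<dots> = ga_scale (g Tj Tk)
        (ga_mult n (ga_mult n (?s Ti Tj) (?P Tj)) (ga_mult n (?N Tj) (?s Tj Tl)))"
      by (simp only: ga_mult_scale_left ga_mult_scale_right assoc)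
    also have "\<dots> = ga_scale (g Tj Tk) (proj_elt n lam Ti Tl)"
      using S by (simp only: right P[symmetric])
    finally show "ga_mult n (proj_elt n lam Ti Tj) (proj_elt n lam Tk Tl)
        = ga_scale (g Tj Tk) (proj_elt n lam Ti Tl)" .
  qed
qed

end
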